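(* Let $n\geqslant2$, let $D\subset\mathbb{R}^n$ be a domain, let $x_0\in D$, and let $f:D\to\mathbb{R}^n$ be a homeomorphism onto its image $f(D)$. Then at every point $x\in D\setminus\{x_0\}$ at which $f$ is differentiable with $J(x,f)\neq0$, $$K_{CT,n,x_0}(x,f^{-1})=D_f(x,x_0).$$
   Context: Here $(\cdot,\cdot)$ is the Euclidean scalar product and $J(x,f)=\det f'(x)$. Cotangent dilatation: for a mapping $g$ of a domain in $\mathbb{R}^n$ into $\mathbb{R}^n$, $p>1$, and a point $y_0\in\mathbb{R}^n$, the cotangent dilatation of $g$ of order $p$ at $y_0$ is $$K_{CT,p,y_0}(y,g)=\sum_{z\in g^{-1}(y)}\frac{\left(\sup_{|h|=1}\left|\left(g'(z)h,\frac{g(z)-y_0}{|g(z)-y_0|}\right)\right|\right)^p}{|J(z,g)|}.$$ For $g=f^{-1}:f(D)\to D$, $p=n$, $y_0=x_0$, $y=x$, the sum consists of the single term $z=f(x)$, so $$K_{CT,n,x_0}(x,f^{-1})=\frac{\left(\sup_{|h|=1}\left|\left((f^{-1})'(f(x))h,\frac{x-x_0}{|x-x_0|}\right)\right|\right)^n}{|J(f(x),f^{-1})|}.$$ Tangential dilatation of $f$ at $x$ with respect to $x_0$: $$D_f(x,x_0)=\frac{|J(x,f)|}{l_f^n(x,x_0)},\qquad l_f(x,x_0)=\min_{|h|=1}\frac{|\partial_hf(x)|}{\left|\left(h,\frac{x-x_0}{|x-x_0|}\right)\right|},\qquad \partial_hf(x)=\lim_{t\to+0}\frac{f(x+th)-f(x)}{t},$$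 where the quotient is interpreted as $+\infty$ when its denominator vanishes. *)

theory Defs
  imports "HOL-Analysis.Analysis"
begin

definition jacobian_det :: "real^'n \<Rightarrow> (real^'n \<Rightarrow> real^'n) \<Rightarrow> real" where
  "jacobian_det x f = det (jacobian f (at x))"

definition unit_dir :: "real^'n \<Rightarrow> real^'n \<Rightarrow> real^'n" where
  "unit_dir x0 x = (x - x0) /\<^sub>R norm (x - x0)"

(* Mappings are total functions, so the domain Omega of g is an explicit parameter; when it is
   open, the values of g outside it do not influence derivatives at its points.
   The preimage of y may be infinite, hence the unordered sum in ennreal, where every family is
   summable. At points where g is not differentiable the summand has no meaning. *)
definition cotangent_dilatation ::
    "(real^'n) set \<Rightarrow> real \<Rightarrow> real^'n \<Rightarrow> real^'n \<Rightarrow> (real^'n \<Rightarrow> real^'n) \<Rightarrow> ennreal" where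
  "cotangent_dilatation \<Omega> p y0 y g =
     (\<Sum>\<^sub>\<infinity>z\<in>{z \<in> \<Omega>. g z = y}.
        ennreal ((SUP h\<in>{h. norm h = 1}.
                    \<bar>frechet_derivative g (at z) h \<bullet> unit_dir y0 (g z)\<bar>) powr p)
        / ennreal \<bar>jacobian_det z g\<bar>)"

definition right_dir_deriv :: "real^'n \<Rightarrow> (real^'n \<Rightarrow> real^'n) \<Rightarrow> real^'n \<Rightarrow> real^'n" where
  "right_dir_deriv h f x = Lim (at_right 0) (\<lambda>t::real. (f (x + t *\<^sub>R h) - f x) /\<^sub>R t)"

(* The quotient is infinite whenever its denominator vanishes, including the case 0/0, for which
   ennreal division would give 0. *)
definition stretch_quotient ::
    "(real^'n \<Rightarrow> real^'n) \<Rightarrow> real^'n \<Rightarrow> real^'n \<Rightarrow> real^'n \<Rightarrow> ennreal" where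
  "stretch_quotient f x x0 h =
     (if h \<bullet> unit_dir x0 x = 0 then \<infinity>
      else ennreal (norm (right_dir_deriv h f x) / \<bar>h \<bullet> unit_dir x0 x\<bar>))"

(* LEAST because the definition asks for a minimum, not merely for an infimum. *)
definition l_min :: "(real^'n \<Rightarrow> real^'n) \<Rightarrow> real^'n \<Rightarrow> real^'n \<Rightarrow> ennreal" where
  "l_min f x x0 = (LEAST r. r \<in> stretch_quotient f x x0 ` {h. norm h = 1})"

definition tangential_dilatation ::
    "(real^'n \<Rightarrow> real^'n) \<Rightarrow> real^'n \<Rightarrow> real^'n \<Rightarrow> ennreal" where
  "tangential_dilatation f x x0 =
     ennreal \<bar>jacobian_det x f\<bar> / (l_min f x x0) ^ CARD('n)"

end

theory Submission
  imports Defs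
begin

text \<open>Write \<open>A\<close> for the derivative of \<open>f\<close> at \<open>x\<close>, \<open>B\<close> for its inverse, \<open>u\<close> for the unit direction
  from \<open>x\<^sub>0\<close> to \<open>x\<close>, and \<open>w\<close> for the adjoint of \<open>B\<close> applied to \<open>u\<close>. Since \<open>B k \<bullet> u = k \<bullet> w\<close>, the
  supremum in the cotangent dilatation is \<open>|w|\<close>. Substituting \<open>k = A h\<close> gives \<open>h \<bullet> u = A h \<bullet> w\<close>, so the
  quotient \<open>|A h| / |h \<bullet> u|\<close> is at least \<open>1 / |w|\<close> by Cauchy--Schwarz, with equality when \<open>A h\<close> is
  parallel to \<open>w\<close>. Finally \<open>det B = 1 / det A\<close>. Invariance of domain makes \<open>f(D)\<close> open, so that
  the derivative of the inverse map at \<open>f(x)\<close> is \<open>B\<close>.\<close>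

text \<open>The chain rule along the ray \<open>x + t *\<^sub>R h\<close> makes the one-sided
  quotient converge. Since \<open>Lim\<close> is a description operator, its value is known only
  once convergence is shown.\<close>

lemma right_dir_deriv_eq:
  fixes f :: "real^'n \<Rightarrow> real^'n"
  assumes "(f has_derivative f') (at x)"
  shows "right_dir_deriv h f x = f' h"
proof -
  define p where "p = (\<lambda>t::real. f (x + t *\<^sub>R h))"
  have "((\<lambda>t::real. x + t *\<^sub>R h) has_derivative (\<lambda>t. t *\<^sub>R h)) (at 0)"
    by (auto intro!: derivative_eq_intros)
  moreover have "(f has_derivative f') (at (x + 0 *\<^sub>R h))"
    using assms by simp
  ultimately have "(p has_derivative (\<lambda>t. f' (t *\<^sub>R h))) (at 0)"
    unfolding p_def by (rule has_derivative_compose)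
  then have "(p has_derivative (\<lambda>t. f' (t *\<^sub>R h))) (at_right 0)"
    by (rule has_derivative_at_withinI)
  then have "((\<lambda>t. (p t - p 0 - f' ((t - 0) *\<^sub>R h)) /\<^sub>R norm (t - 0)) \<longlongrightarrow> 0) (at_right 0)"
    unfolding has_derivative_at_within by (rule conjunct2)
  \<comment> \<open>For positive \<open>t\<close>, \<open>norm t\<close> equals \<open>t\<close>, so
    by linearity the subtracted term becomes exactly \<open>f' h\<close>.\<close>
  moreover have "\<forall>\<^sub>F t in at_right 0. (p t - p 0 - f' ((t - 0) *\<^sub>R h)) /\<^sub>R norm (t - 0)
      = (p t - p 0) /\<^sub>R t - f' h"
    using eventually_at_right_less[of 0]
    by eventually_elim
      (simp add: linear_cmul[OF has_derivative_linear[OF assms]] scaleR_diff_right)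
  ultimately have "((\<lambda>t. (p t - p 0) /\<^sub>R t - f' h) \<longlongrightarrow> 0) (at_right 0)"
    by (rule Lim_transform_eventually)
  then have "((\<lambda>t. (p t - p 0) /\<^sub>R t) \<longlongrightarrow> f' h) (at_right 0)"
    by (rule LIM_zero_cancel)
  then show ?thesis
    unfolding right_dir_deriv_def p_def by (simp add: tendsto_Lim)
qed

text \<open>Cauchy--Schwarz gives the upper bound, and the normalised \<open>w\<close> attains it,
  so the real supremum is a maximum.\<close>

lemma SUP_abs_inner_unit_sphere:
  fixes w :: "'a::real_inner"
  assumes "w \<noteq> 0"
  shows "(SUP h\<in>{h. norm h = 1}. \<bar>h \<bullet> w\<bar>) = norm w"
proof (rule cSup_eq_maximum)
  have "\<bar>(w /\<^sub>R norm w) \<bullet> w\<bar> = norm w"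
    using assms by (simp add: dot_square_norm power2_eq_square)
  moreover have "norm (w /\<^sub>R norm w) = 1"
    using assms by simp
  ultimately show "norm w \<in> (\<lambda>h. \<bar>h \<bullet> w\<bar>) ` {h. norm h = 1}"
    by (metis (mono_tags, lifting) image_eqI mem_Collect_eq)
next
  fix r assume "r \<in> (\<lambda>h. \<bar>h \<bullet> w\<bar>) ` {h. norm h = 1}"
  then obtain h where "r = \<bar>h \<bullet> w\<bar>" "norm h = 1" by auto
  then show "r \<le> norm w"
    using Cauchy_Schwarz_ineq2[of h w] by simp
qed

lemma l_min_eq:
  fixes f :: "real^'n \<Rightarrow> real^'n"
  assumes der: "(f has_derivative (\<lambda>h. A *v h)) (at x)"
    and AB: "A ** B = mat 1" and BA: "B ** A = mat 1"
    and w: "w = unit_dir x0 x v* B" "w \<noteq> 0"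
  shows "l_min f x x0 = ennreal (1 / norm w)"
proof -
  have inner_w: "h \<bullet> unit_dir x0 x = (A *v h) \<bullet> w" for h
    by (metis BA dot_lmul_matrix inner_commute matrix_vector_mul_assoc matrix_vector_mul_lid w(1))
  have ABw: "A *v (B *v w) = w"
    by (simp add: matrix_vector_mul_assoc AB)
  then have Bw: "B *v w \<noteq> 0"
    using w(2) by auto
  \<comment> \<open>The unit vector whose image under \<open>A\<close> is a positive multiple of
    \<open>w\<close>: the equality case of Cauchy--Schwarz.\<close>
  define h0 where "h0 = (B *v w) /\<^sub>R norm (B *v w)"
  have Ah0: "A *v h0 = w /\<^sub>R norm (B *v w)"
    by (simp add: h0_def matrix_vector_mult_scaleR ABw)
  have h0_unit: "h0 \<bullet> unit_dir x0 x = norm w ^ 2 / norm (B *v w)"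
    by (simp add: inner_w Ah0 dot_square_norm divide_inverse mult.commute)
  have h0_min: "stretch_quotient f x x0 h0 = ennreal (1 / norm w)"
    using w(2) Bw
    by (simp add: stretch_quotient_def right_dir_deriv_eq[OF der] Ah0 h0_unit
        divide_simps power2_eq_square)
  show ?thesis
    unfolding l_min_def
  proof (rule Least_equality)
    have "norm h0 = 1"
      using Bw by (simp add: h0_def)
    with h0_min show "ennreal (1 / norm w) \<in> stretch_quotient f x x0 ` {h. norm h = 1}"
      by (metis (mono_tags, lifting) image_eqI mem_Collect_eq)
  next
    fix r assume "r \<in> stretch_quotient f x x0 ` {h. norm h = 1}"
    then obtain h where r: "r = stretch_quotient f x x0 h" by auto
    show "ennreal (1 / norm w) \<le> r"
    \<comment> \<open>Directions orthogonal to \<open>unit_dir x0 x\<close> have infinite quotient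
      by convention and cannot violate the bound.\<close>
    proof (cases "h \<bullet> unit_dir x0 x = 0")
      case True
      then show ?thesis by (simp add: r stretch_quotient_def)
    next
      case False
      have "1 / norm w \<le> norm (A *v h) / \<bar>h \<bullet> unit_dir x0 x\<bar>"
        using Cauchy_Schwarz_ineq2[of "A *v h" w] w(2) False
        by (simp add: inner_w divide_simps)
      with False show ?thesis
        by (simp add: r stretch_quotient_def right_dir_deriv_eq[OF der] ennreal_leI)
    qed
  qed
qed

theorem mainTheorem3:
  fixes f :: "real^'n \<Rightarrow> real^'n" and D :: "(real^'n) set" and x0 x :: "real^'n"
  assumes "CARD('n) \<ge> 2"
    and "open D" and "connected D"
    and "x0 \<in> D"
    and "homeomorphism D (f ` D) f (inv_into D f)"
    and "x \<in> D - {x0}"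
    and "f differentiable (at x)"
    and "jacobian_det x f \<noteq> 0"
  shows "cotangent_dilatation (f ` D) (real CARD('n)) x0 x (inv_into D f)
           = tangential_dilatation f x x0"
proof -
  define g where "g = inv_into D f"
  define A where "A = jacobian f (at x)"
  have hom: "homeomorphism D (f ` D) f g"
    using assms(5) by (simp add: g_def)
  have gf: "g (f z) = z" if "z \<in> D" for z
    using hom that by (simp add: homeomorphism_def)
  have fg: "f (g y) = y" if "y \<in> f ` D" for y
    using hom that by (auto simp: homeomorphism_def)
  have x: "x \<in> D" "x \<noteq> x0" using assms(6) by auto
  have derf: "(f has_derivative (\<lambda>h. A *v h)) (at x)"
    using assms(7) unfolding A_def jacobian_works by simp
  have detA: "det A \<noteq> 0"
    using assms(8) by (simp add: jacobian_det_def A_def)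
  then obtain B where AB: "A ** B = mat 1" and BA: "B ** A = mat 1"
    using invertible_det_nz[of A] by (auto simp: invertible_def)
  have "det A * det B = 1"
    by (metis AB det_I det_mul)
  then have detB: "det B = 1 / det A"
    using detA by (simp add: field_simps)
  have openfD: "open (f ` D)"
    using hom assms(2) gf
    by (intro invariance_of_domain) (auto simp: homeomorphism_def intro: inj_on_inverseI)
  \<comment> \<open>Differentiability of \<open>f\<close> at the single point \<open>x\<close> is
    enough here, because continuity of \<open>g\<close> comes from the homeomorphism.\<close>
  have derg: "(g has_derivative (\<lambda>h. B *v h)) (at (f x))"
  proof (rule has_derivative_inverse_basic)
    show "(f has_derivative (\<lambda>h. A *v h)) (at (g (f x)))"
      using derf gf x by simp
    show "bounded_linear (\<lambda>h. B *v h)"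
      by (rule matrix_vector_mul_bounded_linear)
    show "(\<lambda>h. B *v h) \<circ> (\<lambda>h. A *v h) = id"
      by (auto simp: matrix_vector_mul_assoc BA)
    show "continuous (at (f x)) g"
      using hom openfD x(1) by (auto simp: homeomorphism_def continuous_on_eq_continuous_at)
  qed (use openfD x fg in auto)
  have frech: "frechet_derivative g (at (f x)) = (\<lambda>h. B *v h)"
    using frechet_derivative_at[OF derg] by simp
  have jac: "jacobian_det (f x) g = 1 / det A"
    by (simp add: jacobian_det_def jacobian_def frech detB)
  define u where "u = unit_dir x0 x"
  define w where "w = u v* B"
  have inner_w: "(B *v k) \<bullet> u = k \<bullet> w" for k
    by (metis w_def dot_lmul_matrix inner_commute)
  have "u \<noteq> 0"
    using x by (simp add: u_def unit_dir_def)
  moreover have "u \<bullet> u = (A *v u) \<bullet> w"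
    by (simp add: matrix_vector_mul_assoc BA flip: inner_w)
  ultimately have w0: "w \<noteq> 0" by auto
  \<comment> \<open>Injectivity on \<open>D\<close> reduces the sum to one term.\<close>
  have pre: "{z \<in> f ` D. g z = x} = {f x}"
    using gf x by auto
  have "cotangent_dilatation (f ` D) (real CARD('n)) x0 x g
      = ennreal (norm w powr real CARD('n)) / ennreal \<bar>1 / det A\<bar>"
    using gf[OF x(1)]
    by (simp add: cotangent_dilatation_def pre frech jac inner_w SUP_abs_inner_unit_sphere[OF w0]
        flip: u_def)
  \<comment> \<open>Positivity of \<open>norm w\<close> turns \<open>powr\<close> into a natural
    power; a nonzero determinant makes the \<open>ennreal\<close> quotient a real one.\<close>
  also have "\<dots> = ennreal (norm w ^ CARD('n) * \<bar>det A\<bar>)"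
    using detA w0 by (subst divide_ennreal) (auto simp: powr_realpow field_simps)
  also have "\<dots> = ennreal \<bar>det A\<bar> / ennreal (1 / norm w) ^ CARD('n)"
    using detA w0 by (simp add: ennreal_power divide_ennreal power_one_over field_simps)
  also have "\<dots> = tangential_dilatation f x x0"
    using l_min_eq[OF derf AB BA, of w x0] w0
    by (simp add: tangential_dilatation_def jacobian_det_def A_def w_def u_def)
  finally show ?thesis
    by (simp add: g_def)
qed

end
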